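(* Let $A$ be an Artinian ring. Then $A$ is not a proper union of cosets if and only if the additive group of $A$ is a divisible group.
   Context: Rings are associative and are not assumed to have an identity element; an Artinian ring is a ring satisfying the minimal condition (descending chain condition) on left ideals. A set $S$ is said to be the proper union of the sets $S_1,\ldots,S_n$ ($n\ge 2$ a finite integer) if $\bigcup_{i=1}^n S_i=S$ and $\bigcup_{i\neq k}S_i\neq S$ for every $k=1,\ldots,n$. A coset in a ring $A$ means a set $a+H$ with $a\in A$ and $H$ a subgroup of the additive group of $A$; different cosets in a union may belong to different subgroups. "$A$ is a proper union of cosets" means that there are $n\ge 2$ and cosets $S_1,\ldots,S_n$ such that $A$ is the proper union of $S_1,\ldots,S_n$. *)

theory Defs
  imports "HOL-Algebra.AbelCoset"
begin

text \<open>
  Associative rings without the assumption of an identity element. The record field for the unit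
  is unconstrained and plays no role: the locale \<^locale>\<open>ring\<close> of the library demands
  a unit, so it cannot be used here.
\<close>

locale nonunital_ring = abelian_group R for R (structure) +
  assumes m_closed: "\<lbrakk>x \<in> carrier R; y \<in> carrier R\<rbrakk> \<Longrightarrow> x \<otimes> y \<in> carrier R"
    and m_assoc: "\<lbrakk>x \<in> carrier R; y \<in> carrier R; z \<in> carrier R\<rbrakk>
      \<Longrightarrow> (x \<otimes> y) \<otimes> z = x \<otimes> (y \<otimes> z)"
    and l_distr: "\<lbrakk>x \<in> carrier R; y \<in> carrier R; z \<in> carrier R\<rbrakk>
      \<Longrightarrow> (x \<oplus> y) \<otimes> z = x \<otimes> z \<oplus> y \<otimes> z"
    and r_distr: "\<lbrakk>x \<in> carrier R; y \<in> carrier R; z \<in> carrier R\<rbrakk>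
      \<Longrightarrow> z \<otimes> (x \<oplus> y) = z \<otimes> x \<oplus> z \<otimes> y"

locale left_ideal = additive_subgroup I R + nonunital_ring R for I and R (structure) +
  assumes l_mult_closed: "\<lbrakk>a \<in> I; x \<in> carrier R\<rbrakk> \<Longrightarrow> x \<otimes> a \<in> I"

locale artinian_ring = nonunital_ring +
  assumes minimal_condition:
    "\<lbrakk>\<F> \<noteq> {}; \<And>I. I \<in> \<F> \<Longrightarrow> left_ideal I R\<rbrakk>
      \<Longrightarrow> \<exists>M\<in>\<F>. \<forall>J\<in>\<F>. J \<subseteq> M \<longrightarrow> J = M"

locale divisible_group = comm_group +
  assumes divisible: "\<lbrakk>(n::nat) > 0; a \<in> carrier G\<rbrakk> \<Longrightarrow> \<exists>b\<in>carrier G. b [^] n = a"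

text \<open>The sets are given as a family indexed by \<open>1, \<dots>, n\<close>, so repetitions are not excluded
  syntactically; they are excluded by irredundancy.\<close>

definition proper_union :: "'a set \<Rightarrow> nat \<Rightarrow> (nat \<Rightarrow> 'a set) \<Rightarrow> bool" where
  "proper_union S n T \<longleftrightarrow>
     n \<ge> 2 \<and> (\<Union>i\<in>{1..n}. T i) = S \<and> (\<forall>k\<in>{1..n}. (\<Union>i\<in>{1..n} - {k}. T i) \<noteq> S)"

definition additive_coset :: "('a, 'm) ring_scheme \<Rightarrow> 'a set \<Rightarrow> bool" where
  "additive_coset R S \<longleftrightarrow> (\<exists>a\<in>carrier R. \<exists>H. additive_subgroup H R \<and> S = a <+\<^bsub>R\<^esub> H)"

definition proper_union_of_cosets :: "('a, 'm) ring_scheme \<Rightarrow> bool" where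
  "proper_union_of_cosets R \<longleftrightarrow>
     (\<exists>n T. (\<forall>i\<in>{1..n}. additive_coset R (T i)) \<and> proper_union (carrier R) n T)"

end

theory Submission
  imports Defs "HOL-Algebra.Left_Coset" "HOL-Algebra.Multiplicative_Group"
    "HOL-Computational_Algebra.Primes"
begin

text \<open>
  Everything happens in the additive group; both sides of the equivalence say that this abelian
  group \<open>G\<close> has no proper subgroup of finite index.

  \<^emph>\<open>Proper unions and finite index.\<close> If a proper subgroup has finite index, then its cosets are
  pairwise disjoint, there are at least two of them, and they form a proper union
  (\<open>proper_union_of_lcosets\<close>). Conversely, B. H. Neumann's lemma
  (\<open>finite_cover_by_lcosets_imp_finite_index\<close>) says that whenever finitely many cosets cover a
  group, one of the subgroups involved has finite index. In a proper union that subgroup is not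
  the whole group: otherwise its coset alone would be everything and any of the other cosets
  could be dropped.

  \<^emph>\<open>Divisibility and finite index.\<close> If \<open>H\<close> has index \<open>n\<close>, then \<open>n G \<subseteq> H\<close>, and \<open>n G = G\<close> when
  \<open>G\<close> is divisible (\<open>finite_index_imp_eq_carrier\<close>). If \<open>G\<close> is not divisible, then \<open>p G \<noteq> G\<close> for
  some prime \<open>p\<close>, so \<open>G / p G\<close> is a nonzero vector space over the field with \<open>p\<close> elements. It has
  a hyperplane, whose preimage in \<open>G\<close> is a subgroup of index \<open>p\<close>. In the formal text the
  hyperplane is a subgroup containing \<open>p G\<close> that is maximal among those avoiding a fixed element
  outside \<open>p G\<close> (\<open>maximal_subgroup_avoiding\<close>, \<open>maximal_avoiding_has_finite_index\<close>).
\<close>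

(* Left cosets and strict inclusion of multisets share this infix symbol. *)
no_notation subset_mset (infix "<#" 50)

section \<open>Covering a group by finitely many cosets\<close>

text \<open>
  B. H. Neumann's lemma, by induction on the number of subgroups. If the cosets of \<open>H\<close> in the
  cover are not all the cosets of \<open>H\<close>, then a missing one, \<open>c H\<close>, is disjoint from those present
  and hence covered by the cosets of the other subgroups. Translating this cover of \<open>c H\<close>
  replaces each coset of \<open>H\<close> by finitely many cosets of the other subgroups.
\<close>

lemma (in group) finite_cover_by_lcosets_imp_finite_index:
  assumes "finite \<H>"
    and "\<And>H. H \<in> \<H> \<Longrightarrow> subgroup H G"
    and "finite \<C>"
    and "\<C> \<subseteq> (\<Union>H\<in>\<H>. lcosets H)"
    and "carrier G \<subseteq> \<Union>\<C>"
  shows "\<exists>H\<in>\<H>. finite (lcosets H)"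
  using assms
proof (induction \<H> arbitrary: \<C>)
  case empty
  then show ?case by auto
next
  case (insert H \<H>)
  then have H: "subgroup H G" by simp
  show ?case
  proof (cases "lcosets H \<subseteq> \<C>")
    case True
    then show ?thesis using \<open>finite \<C>\<close> finite_subset by blast
  next
    case False
    then obtain c where c: "c \<in> carrier G" and cC: "c <# H \<notin> \<C>"
      by (auto simp: LCOSETS_def)
    define \<D> where "\<D> = {D \<in> \<C>. \<exists>K\<in>\<H>. D \<in> lcosets K}"
    have fin\<D>: "finite \<D>" using \<open>finite \<C>\<close> by (simp add: \<D>_def)
    have cov: "c <# H \<subseteq> \<Union>\<D>"
    proof
      fix x assume x: "x \<in> c <# H"
      then have "x \<in> carrier G" using H c l_coset_carrier by blast
      then obtain C where C: "C \<in> \<C>" "x \<in> C" using insert.prems by blast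
      have "c <# H \<in> lcosets H" using c by (auto simp: LCOSETS_def)
      then have "C \<notin> lcosets H" using lcos_disjoint[OF H, of C "c <# H"] C x cC by blast
      then have "C \<in> \<D>" using C insert.prems(3) by (auto simp: \<D>_def)
      then show "x \<in> \<Union>\<D>" using C by blast
    qed
    have "\<exists>a\<in>carrier G. C = a <# (c <# H)" if "C \<in> lcosets H" for C
    proof -
      obtain b where b: "b \<in> carrier G" "C = b <# H"
        using \<open>C \<in> lcosets H\<close> by (auto simp: LCOSETS_def)
      then have "C = (b \<otimes> inv c) <# (c <# H)"
        using c subgroup.subset[OF H] by (simp add: lcos_m_assoc m_assoc)
      then show ?thesis using b c by blast
    qed
    then obtain t where t: "\<And>C. C \<in> lcosets H \<Longrightarrow> t C \<in> carrier G \<and> C = t C <# (c <# H)"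
      by metis
    \<comment> \<open>A coset \<open>C\<close> of \<open>H\<close> is the translate of \<open>c H\<close> by \<open>t C\<close>, hence covered by the translates
      of the members of \<open>\<D>\<close>.\<close>
    define \<E> where "\<E> = \<D> \<union> (\<lambda>(C, D). t C <# D) ` ((\<C> \<inter> lcosets H) \<times> \<D>)"
    have "\<exists>K\<in>\<H>. finite (lcosets K)"
    proof (rule insert.IH)
      show "subgroup K G" if "K \<in> \<H>" for K using that insert.prems(1) by simp
      show "finite \<E>" using \<open>finite \<C>\<close> fin\<D> by (simp add: \<E>_def)
      have "t C <# D \<in> (\<Union>K\<in>\<H>. lcosets K)" if "C \<in> lcosets H" "D \<in> \<D>" for C D
      proof -
        obtain K d where K: "K \<in> \<H>" "d \<in> carrier G" "D = d <# K"
          using \<open>D \<in> \<D>\<close> by (auto simp: \<D>_def LCOSETS_def)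
        then have "t C <# D = (t C \<otimes> d) <# K"
          using t[OF \<open>C \<in> lcosets H\<close>] insert.prems(1)[of K] subgroup.subset
          by (metis insertI2 lcos_m_assoc)
        then show ?thesis using K t[OF \<open>C \<in> lcosets H\<close>] by (auto simp: LCOSETS_def)
      qed
      then show "\<E> \<subseteq> (\<Union>K\<in>\<H>. lcosets K)" by (auto simp: \<E>_def \<D>_def)
      show "carrier G \<subseteq> \<Union>\<E>"
      proof
        fix x assume "x \<in> carrier G"
        then obtain C where C: "C \<in> \<C>" "x \<in> C" using insert.prems by blast
        show "x \<in> \<Union>\<E>"
        proof (cases "C \<in> lcosets H")
          case True
          then have "x \<in> t C <# (c <# H)" using t C by blast
          then obtain D where "D \<in> \<D>" "x \<in> t C <# D"
            using cov by (auto simp: l_coset_def)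
          then show ?thesis using True C by (auto simp: \<E>_def)
        next
          case False
          then have "C \<in> \<D>" using C insert.prems(3) by (auto simp: \<D>_def)
          then show ?thesis using C by (auto simp: \<E>_def)
        qed
      qed
    qed
    then show ?thesis by blast
  qed
qed

section \<open>Divisibility and subgroups of finite index\<close>

lemma (in comm_group) lcosets_eq_rcosets:
  assumes "subgroup H G"
  shows "lcosets H = rcosets H"
  using normal.coset_eq[OF subgroup_imp_normal[OF assms]]
  by (simp add: LCOSETS_def RCOSETS_def)

text \<open>Lagrange's theorem in the quotient group: its order is an exponent for it.\<close>

lemma (in comm_group) finite_index_imp_pow_mem:
  assumes H: "subgroup H G" and fin: "finite (lcosets H)"
  shows "\<exists>n::nat. n > 0 \<and> (\<forall>x\<in>carrier G. x [^] n \<in> H)"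
proof -
  interpret H: normal H G using H by (rule subgroup_imp_normal)
  interpret Q: group "G Mod H" by (rule H.factorgroup_is_group)
  have carr: "carrier (G Mod H) = lcosets H"
    by (simp add: FactGroup_def lcosets_eq_rcosets[OF H])
  let ?n = "order (G Mod H)"
  have "x [^] ?n \<in> H" if x: "x \<in> carrier G" for x
  proof -
    have "H #> x \<in> carrier (G Mod H)" using x by (auto simp: FactGroup_def RCOSETS_def)
    then have "(H #> x) [^]\<^bsub>G Mod H\<^esub> ?n = H"
      using Q.pow_order_eq_1[of "H #> x"] by simp
    then have "H #> (x [^] ?n) = H"
      using H.FactGroup_pow[OF x, of ?n] by simp
    then show ?thesis using x rcos_self[OF _ H] by (metis nat_pow_closed)
  qed
  moreover have "?n > 0" using Q.order_gt_0_iff_finite fin carr by simp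
  ultimately show ?thesis by blast
qed

lemma (in divisible_group) finite_index_imp_eq_carrier:
  assumes "subgroup H G" and "finite (lcosets H)"
  shows "H = carrier G"
proof
  show "H \<subseteq> carrier G" using assms(1) by (rule subgroup.subset)
  obtain n :: nat where n: "n > 0" "\<forall>x\<in>carrier G. x [^] n \<in> H"
    using finite_index_imp_pow_mem[OF assms] by blast
  show "carrier G \<subseteq> H"
  proof
    fix x assume "x \<in> carrier G"
    then obtain y where "y \<in> carrier G" "y [^] n = x" using divisible[OF n(1)] by blast
    then show "x \<in> H" using n(2) by auto
  qed
qed

text \<open>
  If all prime power maps are surjective, then so is every power map with positive exponent, as
  a composition of such maps.
\<close>

lemma (in comm_group) not_divisible_imp_prime_power_map_not_surj:
  assumes "\<not> divisible_group G"
  obtains p :: nat and x where "prime p" "x \<in> carrier G" "\<And>y. y \<in> carrier G \<Longrightarrow> y [^] p \<noteq> x"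
proof -
  have "divisible_group G"
    if surj: "\<And>p x. prime (p::nat) \<Longrightarrow> x \<in> carrier G \<Longrightarrow> \<exists>y\<in>carrier G. y [^] p = x"
  proof
    fix n :: nat and a assume "n > 0" "a \<in> carrier G"
    then show "\<exists>b\<in>carrier G. b [^] n = a"
    proof (induction n arbitrary: a rule: less_induct)
      case (less n)
      show ?case
      proof (cases "n = 1")
        case True
        then show ?thesis using less.prems by (intro bexI[of _ a]) auto
      next
        case False
        then obtain p m where p: "prime p" "n = p * m" using prime_factor_nat by (metis dvdE)
        have "m < n" "m > 0" using p less.prems(1) prime_gt_1_nat[OF p(1)] by auto
        then obtain c where c: "c \<in> carrier G" "c [^] m = a" using less by blast
        obtain b where "b \<in> carrier G" "b [^] p = c" using surj p c by blast
        then show ?thesis using c p by (auto simp: nat_pow_pow[symmetric])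
      qed
    qed
  qed
  then show ?thesis using assms that by metis
qed

lemma (in comm_group) subgroup_image_pow:
  "subgroup ((\<lambda>x. x [^] (n::nat)) ` carrier G) G"
proof
  fix x y assume "x \<in> (\<lambda>x. x [^] n) ` carrier G" "y \<in> (\<lambda>x. x [^] n) ` carrier G"
  then obtain u v where "u \<in> carrier G" "v \<in> carrier G" "x = u [^] n" "y = v [^] n" by blast
  then show "x \<otimes> y \<in> (\<lambda>x. x [^] n) ` carrier G"
    by (auto simp: nat_pow_distrib[symmetric])
next
  show "\<one> \<in> (\<lambda>x. x [^] n) ` carrier G" by (rule image_eqI[of _ _ \<one>]) auto
next
  fix x assume "x \<in> (\<lambda>x. x [^] n) ` carrier G"
  then show "inv x \<in> (\<lambda>x. x [^] n) ` carrier G"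
    by (auto simp: nat_pow_inv[symmetric])
qed auto

lemma (in group) maximal_subgroup_avoiding:
  assumes P: "subgroup P G" and x: "x \<notin> P"
  obtains M where "subgroup M G" "P \<subseteq> M" "x \<notin> M"
    "\<And>N. subgroup N G \<Longrightarrow> M \<subseteq> N \<Longrightarrow> x \<notin> N \<Longrightarrow> N = M"
proof -
  let ?S = "{M. subgroup M G \<and> P \<subseteq> M \<and> x \<notin> M}"
  have "\<exists>M\<in>?S. \<forall>N\<in>?S. M \<subseteq> N \<longrightarrow> N = M"
  proof (rule subset_Zorn_nonempty)
    show "?S \<noteq> {}" using assms by blast
  next
    fix \<C> assume ne: "\<C> \<noteq> {}" and ch: "subset.chain ?S \<C>"
    have sg: "subgroup M G" "P \<subseteq> M" "x \<notin> M" if "M \<in> \<C>" for M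
      using ch that by (auto simp: subset.chain_def)
    have "subgroup (\<Union>\<C>) G"
    proof
      fix a b assume "a \<in> \<Union>\<C>" "b \<in> \<Union>\<C>"
      then obtain M N where MN: "M \<in> \<C>" "N \<in> \<C>" "a \<in> M" "b \<in> N" by blast
      then have "M \<subseteq> N \<or> N \<subseteq> M" using ch by (auto simp: subset_chain_def)
      then show "a \<otimes> b \<in> \<Union>\<C>"
        using MN sg(1) by (meson UnionI subgroup.m_closed subsetD)
    next
      show "\<Union>\<C> \<subseteq> carrier G" using subgroup.subset[OF sg(1)] by blast
      show "\<one> \<in> \<Union>\<C>" using subgroup.one_closed[OF sg(1)] ne by blast
      show "inv a \<in> \<Union>\<C>" if "a \<in> \<Union>\<C>" for a
        using that subgroup.m_inv_closed[OF sg(1)] by auto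
    qed
    moreover have "P \<subseteq> \<Union>\<C>" "x \<notin> \<Union>\<C>" using ne sg(2,3) by blast+
    ultimately show "\<Union>\<C> \<in> ?S" by simp
  qed
  then obtain M where M: "M \<in> ?S" and max: "\<forall>N\<in>?S. M \<subseteq> N \<longrightarrow> N = M" by (rule bexE)
  show ?thesis
  proof (rule that)
    show "subgroup M G" "P \<subseteq> M" "x \<notin> M" using M by auto
    show "N = M" if "subgroup N G" "M \<subseteq> N" "x \<notin> N" for N using that M max by auto
  qed
qed

text \<open>
  In the vector space \<open>G / M\<close> over the field with \<open>p\<close> elements, every nonzero subspace contains
  the class of \<open>x\<close>. Hence the space is spanned by that class and has only \<open>p\<close> elements.
  Concretely, for \<open>y\<close> outside \<open>M\<close> one has \<open>x = m y\<^sup>k\<close> with \<open>m\<close> in \<open>M\<close> and \<open>k\<close> prime to \<open>p\<close>, and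
  inverting \<open>k\<close> modulo \<open>p\<close> expresses \<open>y\<close> as a power of \<open>x\<close> modulo \<open>M\<close>.
\<close>

lemma (in comm_group) maximal_avoiding_has_finite_index:
  fixes p :: nat
  assumes p: "prime p" and M: "subgroup M G" and pow: "\<And>y. y \<in> carrier G \<Longrightarrow> y [^] p \<in> M"
    and x: "x \<in> carrier G" "x \<notin> M"
    and max: "\<And>N. subgroup N G \<Longrightarrow> M \<subseteq> N \<Longrightarrow> x \<notin> N \<Longrightarrow> N = M"
  shows "finite (lcosets M)"
proof -
  have pow_dvd: "y [^] (int p * k) \<in> M" if "y \<in> carrier G" for y and k :: int
    using subgroup_int_pow_closed[OF M pow[OF that], of k] that
    by (metis int_pow_int int_pow_pow)
  have "\<exists>u::int. \<exists>m\<in>M. y = x [^] u \<otimes> m" if y: "y \<in> carrier G" for y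
  proof (cases "y \<in> M")
    case True
    then show ?thesis using y by (intro exI[of _ 0] bexI[of _ y]) auto
  next
    case False
    let ?Y = "generate G {y}"
    have Y: "subgroup ?Y G" using y by (simp add: generate_is_subgroup)
    have "M \<subseteq> M <#> ?Y"
      using subgroup.mem_carrier[OF M] subgroup.one_closed[OF Y] by (force simp: set_mult_def)
    moreover have "y \<in> M <#> ?Y"
      using y subgroup.one_closed[OF M] generate.incl[of y "{y}" G] by (force simp: set_mult_def)
    ultimately have "x \<in> M <#> ?Y"
      using max[OF mult_subgroups[OF M Y]] False by blast
    then obtain m k where mk: "m \<in> M" "x = m \<otimes> y [^] (k::int)"
      using generate_pow[OF y] by (auto simp: set_mult_def)
    have mc: "m \<in> carrier G" using mk(1) by (rule subgroup.mem_carrier[OF M])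
    have "\<not> int p dvd k"
    proof
      assume "int p dvd k"
      then have "y [^] k \<in> M" using pow_dvd[OF y] by (auto elim!: dvdE)
      then show False using mk x(2) subgroup.m_closed[OF M] by blast
    qed
    then have "coprime k (int p)"
      using p prime_imp_coprime[of "int p" k] by (simp add: coprime_commute)
    then obtain u v where "u * k + v * int p = 1" using bezout_int[of k "int p"] by auto
    then have uv: "1 = k * u + int p * v" by (simp add: algebra_simps)
    have "y = y [^] (k * u + int p * v)" using uv y by (metis int_pow_1)
    also have "\<dots> = (y [^] k) [^] u \<otimes> y [^] (int p * v)"
      using y by (simp add: int_pow_mult int_pow_pow)
    also have "y [^] k = x \<otimes> inv m"
      using mk mc y m_comm[of m "y [^] k"] by (simp add: m_assoc)
    also have "(x \<otimes> inv m) [^] u \<otimes> y [^] (int p * v) = x [^] u \<otimes> (inv m [^] u \<otimes> y [^] (int p * v))"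
      using x mc y by (simp add: int_pow_distrib m_assoc)
    finally show ?thesis
      using subgroup.m_closed[OF M subgroup_int_pow_closed[OF M subgroup.m_inv_closed[OF M mk(1)]] pow_dvd[OF y]]
      by blast
  qed
  note span = this
  \<comment> \<open>As \<open>x\<^sup>p\<close> lies in \<open>M\<close>, only the exponent modulo \<open>p\<close> matters for the coset.\<close>
  have "lcosets M \<subseteq> (\<lambda>r::int. x [^] r <# M) ` {0..<int p}"
  proof
    fix C assume "C \<in> lcosets M"
    then obtain y where y: "y \<in> carrier G" "C = y <# M" by (auto simp: LCOSETS_def)
    obtain u :: int and m where um: "m \<in> M" "y = x [^] u \<otimes> m" using span y by blast
    let ?r = "u mod int p"
    have "x [^] u = x [^] ?r \<otimes> x [^] (int p * (u div int p))"
      using x by (metis int_pow_mult mod_mult_div_eq)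
    then have "y = x [^] ?r \<otimes> (x [^] (int p * (u div int p)) \<otimes> m)"
      using um x subgroup.mem_carrier[OF M um(1)] by (simp add: m_assoc)
    moreover have "x [^] (int p * (u div int p)) \<otimes> m \<in> M"
      by (rule subgroup.m_closed[OF M pow_dvd[OF x(1)] um(1)])
    ultimately have "y \<in> x [^] ?r <# M" by (auto simp: l_coset_def)
    then have "C = x [^] ?r <# M" using y l_repr_independence[OF _ _ M] x by auto
    moreover have "?r \<in> {0..<int p}" using p prime_gt_0_nat by simp
    ultimately show "C \<in> (\<lambda>r::int. x [^] r <# M) ` {0..<int p}" by blast
  qed
  then show ?thesis by (rule finite_subset) simp
qed

lemma (in comm_group) divisible_group_iff_no_proper_finite_index:
  "divisible_group G \<longleftrightarrow> (\<forall>H. subgroup H G \<and> finite (lcosets H) \<longrightarrow> H = carrier G)"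
proof
  assume "divisible_group G"
  then show "\<forall>H. subgroup H G \<and> finite (lcosets H) \<longrightarrow> H = carrier G"
    using divisible_group.finite_index_imp_eq_carrier by blast
next
  assume no: "\<forall>H. subgroup H G \<and> finite (lcosets H) \<longrightarrow> H = carrier G"
  show "divisible_group G"
  proof (rule ccontr)
    assume "\<not> divisible_group G"
    then obtain p :: nat and x where p: "prime p" and x: "x \<in> carrier G"
      and nx: "\<And>y. y \<in> carrier G \<Longrightarrow> y [^] p \<noteq> x"
      using not_divisible_imp_prime_power_map_not_surj by blast
    have "x \<notin> (\<lambda>y. y [^] p) ` carrier G" using nx by blast
    from maximal_subgroup_avoiding[OF subgroup_image_pow this]
    obtain M where M: "subgroup M G" "(\<lambda>y. y [^] p) ` carrier G \<subseteq> M" "x \<notin> M"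
      "\<And>N. subgroup N G \<Longrightarrow> M \<subseteq> N \<Longrightarrow> x \<notin> N \<Longrightarrow> N = M" by blast
    have "finite (lcosets M)"
      by (rule maximal_avoiding_has_finite_index[where p = p and x = x]) (use p x M in auto)
    then show False using no M x by blast
  qed
qed

section \<open>Proper unions and subgroups of finite index\<close>

lemma (in group) proper_union_of_lcosets:
  assumes H: "subgroup H G" and ne: "H \<noteq> carrier G" and fin: "finite (lcosets H)"
  shows "\<exists>n T. (\<forall>i\<in>{1..n}. T i \<in> lcosets H) \<and> proper_union (carrier G) n T"
proof -
  obtain T where T: "bij_betw T {1..card (lcosets H)} (lcosets H)"
    using ex_bij_betw_nat_finite_1[OF fin] by blast
  let ?n = "card (lcosets H)"
  have im: "T ` {1..?n} = lcosets H" and inj: "inj_on T {1..?n}"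
    using T by (auto simp: bij_betw_def)
  have mem: "T i \<in> lcosets H" if "i \<in> {1..?n}" for i using im that by blast
  have un: "(\<Union>i\<in>{1..?n}. T i) = carrier G" using im lcosets_part_G[OF H] by simp
  have two: "?n \<ge> 2"
  proof -
    obtain x where x: "x \<in> carrier G" "x \<notin> H" using ne subgroup.subset[OF H] by blast
    have "\<one> <# H \<in> lcosets H" "x <# H \<in> lcosets H" using x by (auto simp: LCOSETS_def)
    moreover have "\<one> <# H \<noteq> x <# H"
      using lcos_self[OF x(1) H] x(2) lcos_mult_one[OF subgroup.subset[OF H]] by auto
    ultimately have "card {\<one> <# H, x <# H} \<le> ?n" "card {\<one> <# H, x <# H} = 2"
      using card_mono[OF fin, of "{\<one> <# H, x <# H}"] by auto
    then show ?thesis by simp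
  qed
  have "(\<Union>i\<in>{1..?n} - {k}. T i) \<noteq> carrier G" if k: "k \<in> {1..?n}" for k
  proof -
    obtain a where a: "a \<in> carrier G" "T k = a <# H" using mem[OF k] by (auto simp: LCOSETS_def)
    then have "a \<in> T k" using lcos_self[OF _ H] by simp
    moreover have "T i \<inter> T k = {}" if "i \<in> {1..?n} - {k}" for i
    proof (rule lcos_disjoint[OF H])
      show "T i \<in> lcosets H" "T k \<in> lcosets H" using mem that k by auto
      show "T i \<noteq> T k" using inj_onD[OF inj _ _ k, of i] that by blast
    qed
    ultimately have "a \<notin> (\<Union>i\<in>{1..?n} - {k}. T i)" by blast
    then show ?thesis using a by blast
  qed
  then have "proper_union (carrier G) ?n T" using two un by (simp add: proper_union_def)
  then show ?thesis using mem by blast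
qed

lemma (in abelian_group) additive_coset_iff_lcosets:
  "additive_coset G S \<longleftrightarrow> (\<exists>H. subgroup H (add_monoid G) \<and> S \<in> lcosets\<^bsub>add_monoid G\<^esub> H)"
  by (auto simp: additive_coset_def additive_subgroup_def LCOSETS_def a_l_coset_def)

lemma (in abelian_group) proper_union_of_cosets_iff_proper_finite_index:
  "proper_union_of_cosets G \<longleftrightarrow>
    (\<exists>H. subgroup H (add_monoid G) \<and> finite (lcosets\<^bsub>add_monoid G\<^esub> H) \<and> H \<noteq> carrier G)"
proof
  assume "proper_union_of_cosets G"
  then obtain n T where cos: "\<And>i. i \<in> {1..n} \<Longrightarrow> additive_coset G (T i)"
    and pu: "proper_union (carrier G) n T"
    unfolding proper_union_of_cosets_def by blast
  then obtain K where K: "\<And>i. i \<in> {1..n} \<Longrightarrow> subgroup (K i) (add_monoid G)"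
    "\<And>i. i \<in> {1..n} \<Longrightarrow> T i \<in> lcosets\<^bsub>add_monoid G\<^esub> (K i)"
    unfolding additive_coset_iff_lcosets by metis
  have "\<exists>H\<in>K ` {1..n}. finite (lcosets\<^bsub>add_monoid G\<^esub> H)"
    by (rule add.finite_cover_by_lcosets_imp_finite_index[where \<C> = "T ` {1..n}"])
      (use K pu in \<open>auto simp: proper_union_def\<close>)
  then obtain i where i: "i \<in> {1..n}" and fin: "finite (lcosets\<^bsub>add_monoid G\<^esub> (K i))" by blast
  have "K i \<noteq> carrier G"
  proof
    assume "K i = carrier G"
    then have Ti: "T i = carrier G"
      using K(2)[OF i] add.coset_join3[OF _ K(1)[OF i]]
      by (auto simp: LCOSETS_def)
    obtain k where k: "k \<in> {1..n}" "k \<noteq> i"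
    proof (cases "i = 1")
      case True
      then show ?thesis using that[of 2] pu by (simp add: proper_union_def)
    next
      case False
      then show ?thesis using that[of 1] i by simp
    qed
    have "(\<Union>j\<in>{1..n} - {k}. T j) = carrier G"
    proof
      show "(\<Union>j\<in>{1..n} - {k}. T j) \<subseteq> carrier G" using pu by (auto simp: proper_union_def)
      show "carrier G \<subseteq> (\<Union>j\<in>{1..n} - {k}. T j)" using i k(2) Ti by blast
    qed
    then show False using pu k(1) unfolding proper_union_def by blast
  qed
  then show "\<exists>H. subgroup H (add_monoid G) \<and> finite (lcosets\<^bsub>add_monoid G\<^esub> H) \<and> H \<noteq> carrier G"
    using K(1)[OF i] fin by blast
next
  assume "\<exists>H. subgroup H (add_monoid G) \<and> finite (lcosets\<^bsub>add_monoid G\<^esub> H) \<and> H \<noteq> carrier G"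
  then show "proper_union_of_cosets G"
    using add.proper_union_of_lcosets unfolding proper_union_of_cosets_def additive_coset_iff_lcosets
    by fastforce
qed

theorem corollary1:
  fixes A (structure)
  assumes "artinian_ring A"
  shows "\<not> proper_union_of_cosets A \<longleftrightarrow> divisible_group (add_monoid A)"
proof -
  interpret artinian_ring A by fact
  show ?thesis
    using proper_union_of_cosets_iff_proper_finite_index
      comm_group.divisible_group_iff_no_proper_finite_index[OF a_comm_group]
    by auto
qed

end
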